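(* Let $L_0$ be the space of (classes of) Lebesgue measurable functions $[0,1]\to\mathbb{R}$, where functions equal a.e. are identified, with the topology of convergence in measure, and endow $L_0^{\mathbb{N}}$ with the product topology. Let $NUP([0,1])\subset L_0^{\mathbb{N}}$ be the family of sequences $(f_n)_n$ such that (A) $f_n\to 0$ pointwise a.e. in $[0,1]$; (B) for every $\varepsilon>0$ there is a measurable set $E\subset[0,1]$ such that $m(E)<\varepsilon$ and $\operatorname{ess\,sup}_{[0,1]\setminus E}|f_n|\to 0$ as $n\to\infty$; (C) $(f_n)_n$ does not converge uniformly a.e. in $[0,1]$. Then $NUP([0,1])$ is maximal dense-lineable in $L_0^{\mathbb{N}}$.
   Context: $m$ is Lebesgue measure on $[0,1]$. The topology on $L_0$ is the one given by the metric $\rho(f,g)=\int_{[0,1]}\frac{|f(x)-g(x)|}{1+|f(x)-g(x)|}\,dx$, for which $\rho(f_n,f)\to0$ if and only if $f_n\to f$ in measure. The topology on $L_0^{\mathbb{N}}$ is the one given by the product metric $D((f_n)_n,(g_n)_n)=\sum_{n=1}^\infty \frac{1}{2^n}\cdot\frac{\rho(f_n,g_n)}{1+\rho(f_n,g_n)}$; with it $L_0^{\mathbb{N}}$ is a separable, complete metrizable topological vector space (with coordinatewise operations). For $A\subset[0,1]$ measurable, $\operatorname{ess\,sup}_{A} f:=\inf\{\alpha\in\mathbb{R}: m(\{x\in A: f(x)>\alpha\})=0\}$. A sequence $(f_n)_n$ converges to $f$ uniformly a.e. in $[0,1]$ if there is $E\subset[0,1]$ with $m(E)=0$ such that $f_n\to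 f$ uniformly on $[0,1]\setminus E$. A subset $A$ of a topological vector space $X$ is maximal dense-lineable in $X$ if there is a dense vector subspace $M$ of $X$ with $M\setminus\{0\}\subset A$ and $\dim(M)=\dim(X)$, where $\dim$ is the algebraic (Hamel) dimension. *)

theory Defs
  imports
    "HOL-Analysis.Analysis"
    "HOL-Library.Function_Algebras"
    "HOL-Library.Equipollence"
    "HOL-Probability.Essential_Supremum"
begin

section \<open>Real topological vector spaces and maximal dense-lineability\<close>

class real_tvs = real_vector + topological_ab_group_add +
  assumes tendsto_scaleR_nhds:
    "((\<lambda>p. fst p *\<^sub>R snd p) \<longlongrightarrow> c *\<^sub>R x) (nhds (c::real) \<times>\<^sub>F nhds x)"

text \<open>Hamel dimension is a cardinal number, so the natural number \<^const>\<open>dim\<close> does not express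
  it for infinite-dimensional spaces; equality of dimensions is equipotence of Hamel bases.\<close>

definition is_hamel_basis :: "'a::real_vector set \<Rightarrow> 'a set \<Rightarrow> bool" where
  "is_hamel_basis B V \<longleftrightarrow> independent B \<and> span B = V"

definition same_hamel_dim :: "'a::real_vector set \<Rightarrow> 'b::real_vector set \<Rightarrow> bool" where
  "same_hamel_dim V W \<longleftrightarrow> (\<exists>B C. is_hamel_basis B V \<and> is_hamel_basis C W \<and> B \<approx> C)"

definition maximal_dense_lineable :: "'a::real_tvs set \<Rightarrow> bool" where
  "maximal_dense_lineable A \<longleftrightarrow>
     (\<exists>M. subspace M \<and> closure M = UNIV \<and> M - {0} \<subseteq> A \<and> same_hamel_dim M (UNIV :: 'a set))"


section \<open>Sequence spaces with coordinatewise operations and product topology\<close>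

text \<open>The additive structure on functions comes from \<^theory>\<open>HOL-Library.Function_Algebras\<close>,
  the topology (the product topology) from \<^theory>\<open>HOL-Analysis.Function_Topology\<close>.\<close>

instantiation "fun" :: (type, real_vector) real_vector
begin

definition scaleR_fun :: "real \<Rightarrow> ('a \<Rightarrow> 'b) \<Rightarrow> 'a \<Rightarrow> 'b" where
  "c *\<^sub>R f = (\<lambda>i. c *\<^sub>R f i)"

instance
  by standard (simp_all add: scaleR_fun_def fun_eq_iff scaleR_add_right scaleR_add_left)

end

lemma scaleR_fun_apply [simp]: "(c *\<^sub>R f) i = c *\<^sub>R f i"
  by (simp add: scaleR_fun_def)

lemma tendsto_fun_iff:
  fixes f :: "'c \<Rightarrow> 'a \<Rightarrow> 'b::topological_space"
  shows "(f \<longlongrightarrow> l) F \<longleftrightarrow> (\<forall>i. ((\<lambda>x. f x i) \<longlongrightarrow> l i) F)"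
proof -
  have "(f \<longlongrightarrow> l) F \<longleftrightarrow> limitin (product_topology (\<lambda>i. euclidean) UNIV) f l F"
    by (simp add: euclidean_product_topology flip: limitin_canonical_iff)
  also have "\<dots> \<longleftrightarrow> (\<forall>i. ((\<lambda>x. f x i) \<longlongrightarrow> l i) F)"
    by (simp add: limitin_componentwise)
  finally show ?thesis .
qed

lemma tendsto_fun_apply_nhds: "((\<lambda>f. f i) \<longlongrightarrow> (g::'a \<Rightarrow> 'b::topological_space) i) (nhds g)"
  using tendsto_fun_iff[of "\<lambda>f. f" g "nhds g"] by (simp add: filterlim_ident)

instance "fun" :: (type, real_tvs) real_tvs
proof
  fix f g :: "'a \<Rightarrow> 'b" and c :: real
  have a: "((\<lambda>p. fst p i + snd p i) \<longlongrightarrow> f i + g i) (nhds f \<times>\<^sub>F nhds g)" for i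
    by (rule tendsto_add[OF filterlim_compose[OF tendsto_fun_apply_nhds filterlim_fst]
        filterlim_compose[OF tendsto_fun_apply_nhds filterlim_snd]])
  show "((\<lambda>p. fst p + snd p) \<longlongrightarrow> f + g) (nhds f \<times>\<^sub>F nhds g)"
    unfolding tendsto_fun_iff using a by simp
  show "(uminus \<longlongrightarrow> - f) (nhds f)"
    unfolding tendsto_fun_iff by (auto intro!: tendsto_minus tendsto_fun_apply_nhds)
  have "((\<lambda>p. fst p *\<^sub>R snd p i) \<longlongrightarrow> c *\<^sub>R f i) (nhds c \<times>\<^sub>F nhds f)" for i
  proof -
    have "filterlim (\<lambda>p. (fst p, snd p i)) (nhds c \<times>\<^sub>F nhds (f i)) (nhds c \<times>\<^sub>F nhds f)"
      by (rule filterlim_Pair[OF filterlim_fst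
          filterlim_compose[OF tendsto_fun_apply_nhds filterlim_snd]])
    from filterlim_compose[OF tendsto_scaleR_nhds this] show ?thesis by simp
  qed
  then show "((\<lambda>p. fst p *\<^sub>R snd p) \<longlongrightarrow> c *\<^sub>R f) (nhds c \<times>\<^sub>F nhds f)"
    unfolding tendsto_fun_iff by simp
qed


section \<open>The space \<open>L\<^sub>0\<close>\<close>

abbreviation leb01 :: "real measure" where
  "leb01 \<equiv> lebesgue_on {0..1}"

text \<open>Functions on the unit interval are total functions on the reals whose values off the
  interval are irrelevant: measurability and equality only refer to \<^term>\<open>leb01\<close>.\<close>

definition L0_rel :: "(real \<Rightarrow> real) \<Rightarrow> (real \<Rightarrow> real) \<Rightarrow> bool" where
  "L0_rel f g \<longleftrightarrow> f \<in> borel_measurable leb01 \<and> g \<in> borel_measurable leb01 \<and>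
     (AE x in leb01. f x = g x)"

quotient_type L0 = "real \<Rightarrow> real" / partial: L0_rel
proof (rule part_equivpI)
  show "\<exists>f. L0_rel f f"
    by (rule exI[of _ "\<lambda>_. 0"]) (simp add: L0_rel_def)
  show "symp L0_rel"
    by (rule sympI) (auto simp: L0_rel_def elim: eventually_mono)
  show "transp L0_rel"
    by (rule transpI) (auto simp: L0_rel_def elim: eventually_elim2)
qed

lemma rep_L0_rel: "L0_rel (rep_L0 f) (rep_L0 f)"
  using Quotient3_rel_rep[OF Quotient3_L0] by metis

lemma rep_L0_measurable [measurable]: "rep_L0 f \<in> borel_measurable leb01"
  using rep_L0_rel[of f] by (simp add: L0_rel_def)

lemma rep_abs_L0:
  assumes "f \<in> borel_measurable leb01"
  shows "AE x in leb01. rep_L0 (abs_L0 f) x = f x"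
  using Quotient3_rep_abs[OF Quotient3_L0, of f] assms by (simp add: L0_rel_def)

lemma L0_eq_iff: "f = g \<longleftrightarrow> (AE x in leb01. rep_L0 f x = rep_L0 g x)"
  using Quotient3_rel_rep[OF Quotient3_L0, of f g] by (simp add: L0_rel_def)

lemma integrable_bdd_frac:
  fixes f g :: "real \<Rightarrow> real"
  assumes [measurable]: "f \<in> borel_measurable leb01" "g \<in> borel_measurable leb01"
  shows "integrable leb01 (\<lambda>x. \<bar>f x - g x\<bar> / (1 + \<bar>f x - g x\<bar>))"
proof -
  interpret finite_measure leb01
    by (rule finite_measure_lebesgue_on) simp
  show ?thesis
    by (rule integrable_const_bound[where B = 1]) (auto simp: divide_simps)
qed

instantiation L0 :: real_vector
begin

lift_definition zero_L0 :: L0 is "\<lambda>_. 0"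
  by (simp add: L0_rel_def)

lift_definition plus_L0 :: "L0 \<Rightarrow> L0 \<Rightarrow> L0" is "\<lambda>f g x. f x + g x"
  by (auto simp: L0_rel_def elim: eventually_elim2)

lift_definition uminus_L0 :: "L0 \<Rightarrow> L0" is "\<lambda>f x. - f x"
  by (auto simp: L0_rel_def elim: eventually_mono)

lift_definition minus_L0 :: "L0 \<Rightarrow> L0 \<Rightarrow> L0" is "\<lambda>f g x. f x - g x"
  by (auto simp: L0_rel_def elim: eventually_elim2)

lift_definition scaleR_L0 :: "real \<Rightarrow> L0 \<Rightarrow> L0" is "\<lambda>c f x. c * f x"
  by (auto simp: L0_rel_def elim: eventually_mono)

instance
  by standard (transfer; auto simp: L0_rel_def algebra_simps)+

end

lemma frac_mono:
  fixes a b :: real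
  assumes "0 \<le> a" "a \<le> b"
  shows "a / (1 + a) \<le> b / (1 + b)"
proof -
  have "a * (1 + b) \<le> b * (1 + a)"
    using assms by (simp add: algebra_simps)
  then show ?thesis
    using assms by (simp add: frac_le_eq divide_simps)
qed

lemma frac_triangle:
  fixes a b :: real
  assumes "a \<ge> 0" "b \<ge> 0" "c \<ge> 0" "c \<le> a + b"
  shows "c / (1 + c) \<le> a / (1 + a) + b / (1 + b)"
proof -
  have "c / (1 + c) \<le> (a + b) / (1 + (a + b))"
    using assms by (intro frac_mono) auto
  also have "\<dots> = a / (1 + (a + b)) + b / (1 + (a + b))"
    by (simp add: add_divide_distrib)
  also have "\<dots> \<le> a / (1 + a) + b / (1 + b)"
    using assms by (intro add_mono divide_left_mono) auto
  finally show ?thesis .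
qed

instantiation L0 :: metric_space
begin

lift_definition dist_L0 :: "L0 \<Rightarrow> L0 \<Rightarrow> real" is
  "\<lambda>f g. LINT x|leb01. \<bar>f x - g x\<bar> / (1 + \<bar>f x - g x\<bar>)"
  by (rule integral_cong_AE) (auto simp: L0_rel_def elim: eventually_elim2)

definition uniformity_L0 :: "(L0 \<times> L0) filter" where
  "uniformity_L0 = (INF e\<in>{0 <..}. principal {(x, y). dist x y < e})"

definition open_L0 :: "L0 set \<Rightarrow> bool" where
  "open_L0 U \<longleftrightarrow> (\<forall>x\<in>U. eventually (\<lambda>(x', y). x' = x \<longrightarrow> y \<in> U) uniformity)"

instance
proof
  show "(dist f g = 0) = (f = g)" for f g :: L0
  proof (transfer, goal_cases)
    case (1 f g)
    then have [measurable]: "f \<in> borel_measurable leb01" "g \<in> borel_measurable leb01"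
      by (auto simp: L0_rel_def)
    have "(LINT x|leb01. \<bar>f x - g x\<bar> / (1 + \<bar>f x - g x\<bar>)) = 0 \<longleftrightarrow>
        (AE x in leb01. \<bar>f x - g x\<bar> / (1 + \<bar>f x - g x\<bar>) = 0)"
      by (rule integral_nonneg_eq_0_iff_AE) (auto intro: integrable_bdd_frac)
    also have "\<dots> \<longleftrightarrow> (AE x in leb01. f x = g x)"
    proof -
      have *: "\<bar>f x - g x\<bar> / (1 + \<bar>f x - g x\<bar>) = 0 \<longleftrightarrow> f x = g x" for x
        by (auto simp: add_nonneg_eq_0_iff)
      show ?thesis unfolding * ..
    qed
    finally show ?case
      by (simp add: L0_rel_def)
  qed
  show "dist f g \<le> dist f h + dist g h" for f g h :: L0
  proof (transfer, goal_cases)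
    case (1 f g h)
    then have [measurable]: "f \<in> borel_measurable leb01" "g \<in> borel_measurable leb01"
        "h \<in> borel_measurable leb01"
      by (auto simp: L0_rel_def)
    have "(LINT x|leb01. \<bar>f x - g x\<bar> / (1 + \<bar>f x - g x\<bar>)) \<le>
        (LINT x|leb01. \<bar>f x - h x\<bar> / (1 + \<bar>f x - h x\<bar>) + \<bar>g x - h x\<bar> / (1 + \<bar>g x - h x\<bar>))"
      by (intro integral_mono Bochner_Integration.integrable_add integrable_bdd_frac frac_triangle)
         auto
    also have "\<dots> = (LINT x|leb01. \<bar>f x - h x\<bar> / (1 + \<bar>f x - h x\<bar>)) +
        (LINT x|leb01. \<bar>g x - h x\<bar> / (1 + \<bar>g x - h x\<bar>))"
      by (intro Bochner_Integration.integral_add integrable_bdd_frac) auto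
    finally show ?case .
  qed
qed (simp_all add: uniformity_L0_def open_L0_def)

end

lemma dist_L0_translate: "dist (f + h) (g + h) = dist f (g :: L0)"
  by transfer simp

lemma dist_L0_uminus: "dist (- f) (- g) = dist f (g :: L0)"
  by transfer (simp add: abs_minus_commute)

lemma dist_L0_scaleR_le:
  assumes "\<bar>c\<bar> \<le> K" "1 \<le> K"
  shows "dist (c *\<^sub>R f) (c *\<^sub>R g) \<le> K * dist f (g :: L0)"
  using assms
proof (transfer fixing: c K, goal_cases)
  case (1 f g)
  then have [measurable]: "f \<in> borel_measurable leb01" "g \<in> borel_measurable leb01"
    by (auto simp: L0_rel_def)
  have *: "\<bar>c * f x - c * g x\<bar> / (1 + \<bar>c * f x - c * g x\<bar>) \<le>
      K * (\<bar>f x - g x\<bar> / (1 + \<bar>f x - g x\<bar>))" for x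
  proof -
    define t where "t = \<bar>f x - g x\<bar>"
    have t: "t \<ge> 0" "\<bar>c * f x - c * g x\<bar> = \<bar>c\<bar> * t"
      by (simp_all add: t_def abs_mult flip: right_diff_distrib)
    have "\<bar>c\<bar> * t \<le> K * t"
      using 1 t by (intro mult_right_mono) auto
    moreover have "K * t \<ge> t"
      using 1 t mult_right_mono[of 1 K t] by simp
    ultimately have "\<bar>c\<bar> * t / (1 + \<bar>c\<bar> * t) \<le> K * t / (1 + K * t)"
      using t by (intro frac_mono) auto
    also have "\<dots> \<le> K * t / (1 + t)"
      using \<open>K * t \<ge> t\<close> t by (intro divide_left_mono mult_pos_pos) auto
    finally show ?thesis by (simp add: t flip: t_def)
  qed
  have "(LINT x|leb01. \<bar>c * f x - c * g x\<bar> / (1 + \<bar>c * f x - c * g x\<bar>)) \<le>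
      (LINT x|leb01. K * (\<bar>f x - g x\<bar> / (1 + \<bar>f x - g x\<bar>)))"
    by (intro integral_mono * integrable_bdd_frac Bochner_Integration.integrable_mult_right) auto
  then show ?case by (simp only: integral_mult_right_zero)
qed

lemma tendsto_scaleR_left_L0: "((\<lambda>c. c *\<^sub>R f) \<longlongrightarrow> c *\<^sub>R (f :: L0)) (nhds (c::real))"
proof -
  have "continuous (at c) (\<lambda>c. c *\<^sub>R f)"
    unfolding continuous_at_sequentially comp_def
  proof (intro allI impI, rule tendsto_dist_iff[THEN iffD2])
    fix X :: "nat \<Rightarrow> real"
    assume X: "X \<longlonglongrightarrow> c"
    show "(\<lambda>n. dist (X n *\<^sub>R f) (c *\<^sub>R f)) \<longlonglongrightarrow> 0"
      using X
    proof (transfer fixing: X c, goal_cases)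
      case (1 f)
      then have [measurable]: "f \<in> borel_measurable leb01"
        by (auto simp: L0_rel_def)
      have "finite_measure leb01"
        by (rule finite_measure_lebesgue_on) simp
      have "(\<lambda>n. LINT x|leb01. \<bar>X n * f x - c * f x\<bar> / (1 + \<bar>X n * f x - c * f x\<bar>))
          \<longlonglongrightarrow> (LINT x|leb01. 0)"
      proof (rule integral_dominated_convergence[where w = "\<lambda>_. 1"])
        show "integrable leb01 (\<lambda>_. 1 :: real)"
          using finite_measure.integrable_const[OF \<open>finite_measure leb01\<close>] .
        show "AE x in leb01. (\<lambda>n. \<bar>X n * f x - c * f x\<bar> / (1 + \<bar>X n * f x - c * f x\<bar>)) \<longlonglongrightarrow> 0"
        proof (intro AE_I2)
          fix x
          have "(\<lambda>n. \<bar>X n * f x - c * f x\<bar> / (1 + \<bar>X n * f x - c * f x\<bar>))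
              \<longlonglongrightarrow> \<bar>c * f x - c * f x\<bar> / (1 + \<bar>c * f x - c * f x\<bar>)"
            by (intro tendsto_intros 1) auto
          then show "(\<lambda>n. \<bar>X n * f x - c * f x\<bar> / (1 + \<bar>X n * f x - c * f x\<bar>)) \<longlonglongrightarrow> 0"
            by simp
        qed
      qed (auto simp: divide_simps)
      then show ?case by simp
    qed
  qed
  then show ?thesis
    using tendsto_at_iff_tendsto_nhds[of "\<lambda>c. c *\<^sub>R f" c] by (simp add: isCont_def)
qed

instance L0 :: real_tvs
proof
  fix f g :: L0 and c :: real
  show "((\<lambda>p. fst p + snd p) \<longlongrightarrow> f + g) (nhds f \<times>\<^sub>F nhds g)"
  proof (rule tendsto_dist_iff[THEN iffD2], rule tendsto_sandwich[where f = "\<lambda>_. 0"])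
    show "\<forall>\<^sub>F p in nhds f \<times>\<^sub>F nhds g.
        dist (fst p + snd p) (f + g) \<le> dist (fst p) f + dist (snd p) g"
    proof (intro always_eventually allI)
      fix p :: "L0 \<times> L0"
      have "dist (fst p + snd p) (f + g) \<le>
          dist (fst p + snd p) (f + snd p) + dist (snd p + f) (g + f)"
        using dist_triangle[of "fst p + snd p" "f + g" "f + snd p"] by (simp add: add.commute)
      then show "dist (fst p + snd p) (f + g) \<le> dist (fst p) f + dist (snd p) g"
        by (simp only: dist_L0_translate)
    qed
    have "((\<lambda>p. dist (fst p) f + dist (snd p) g) \<longlongrightarrow> dist f f + dist g g) (nhds f \<times>\<^sub>F nhds g)"
      by (intro tendsto_intros filterlim_fst filterlim_snd)
    then show "((\<lambda>p. dist (fst p) f + dist (snd p) g) \<longlongrightarrow> 0) (nhds f \<times>\<^sub>F nhds g)"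
      by simp
  qed (auto intro: tendsto_const)
  show "(uminus \<longlongrightarrow> - f) (nhds f)"
  proof (rule tendsto_dist_iff[THEN iffD2], unfold dist_L0_uminus)
    show "((\<lambda>x. dist x f) \<longlongrightarrow> 0) (nhds f)"
      using tendsto_dist_iff[of "\<lambda>x. x" f "nhds f"] by (simp add: filterlim_ident)
  qed
  show "((\<lambda>p. fst p *\<^sub>R snd p) \<longlongrightarrow> c *\<^sub>R f) (nhds c \<times>\<^sub>F nhds f)"
  proof (rule tendsto_dist_iff[THEN iffD2], rule tendsto_sandwich[where f = "\<lambda>_. 0"])
    have "\<forall>\<^sub>F d in nhds c. \<bar>d\<bar> < \<bar>c\<bar> + 1"
      by (rule order_tendstoD(2)[of _ "\<bar>c\<bar>"]) (auto intro!: tendsto_intros filterlim_ident)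
    then have "\<forall>\<^sub>F p in nhds c \<times>\<^sub>F nhds f. \<bar>fst p\<bar> < \<bar>c\<bar> + 1"
      by (rule eventually_compose_filterlim) (rule filterlim_fst)
    then show "\<forall>\<^sub>F p in nhds c \<times>\<^sub>F nhds f. dist (fst p *\<^sub>R snd p) (c *\<^sub>R f) \<le>
        (\<bar>c\<bar> + 1) * dist (snd p) f + dist (fst p *\<^sub>R f) (c *\<^sub>R f)"
    proof eventually_elim
      case (elim p)
      have "dist (fst p *\<^sub>R snd p) (c *\<^sub>R f) \<le>
          dist (fst p *\<^sub>R snd p) (fst p *\<^sub>R f) + dist (fst p *\<^sub>R f) (c *\<^sub>R f)"
        by (rule dist_triangle)
      with dist_L0_scaleR_le[of "fst p" "\<bar>c\<bar> + 1" "snd p" f] elim show ?case by simp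
    qed
    have "((\<lambda>p. (\<bar>c\<bar> + 1) * dist (snd p) f + dist (fst p *\<^sub>R f) (c *\<^sub>R f)) \<longlongrightarrow>
        (\<bar>c\<bar> + 1) * dist f f + dist (c *\<^sub>R f) (c *\<^sub>R f)) (nhds c \<times>\<^sub>F nhds f)"
      by (intro tendsto_intros filterlim_snd filterlim_compose[OF tendsto_scaleR_left_L0]
          filterlim_fst)
    then show "((\<lambda>p. (\<bar>c\<bar> + 1) * dist (snd p) f + dist (fst p *\<^sub>R f) (c *\<^sub>R f)) \<longlongrightarrow> 0)
        (nhds c \<times>\<^sub>F nhds f)"
      by simp
  qed (auto intro: tendsto_const)
qed


section \<open>The family \<open>NUP\<close>\<close>

text \<open>The essential supremum over a set \<open>A\<close> is \<^const>\<open>esssup\<close> on \<^term>\<open>lebesgue_on A\<close>,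
  with values in the extended reals because the essential supremum of an unbounded function
  (and of any function over a null set) is infinite.\<close>

lemma esssup_lebesgue_on_eq:
  assumes A: "A \<in> sets lebesgue" and f: "f \<in> borel_measurable (lebesgue_on A)"
  shows "esssup (lebesgue_on A) (\<lambda>x. ereal (f x)) =
    Inf (ereal ` {\<alpha>. emeasure lebesgue {x \<in> A. f x > \<alpha>} = 0})" (is "?l = Inf (ereal ` ?S)")
proof -
  have eq: "emeasure (lebesgue_on A) {x \<in> A. P x} = emeasure lebesgue {x \<in> A. P x}" for P
    using A by (intro emeasure_restrict_space) auto
  have l: "?l = Inf {z. emeasure lebesgue {x \<in> A. ereal (f x) > z} = 0}"
    using f by (subst esssup_eq) (auto simp: eq)
  show ?thesis
    unfolding l
  proof (rule antisym)
    show "Inf {z. emeasure lebesgue {x \<in> A. ereal (f x) > z} = 0} \<le> Inf (ereal ` ?S)"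
      by (rule Inf_superset_mono) auto
    show "Inf (ereal ` ?S) \<le> Inf {z. emeasure lebesgue {x \<in> A. ereal (f x) > z} = 0}"
    proof (rule Inf_greatest, safe)
      fix z assume z: "emeasure lebesgue {x \<in> A. ereal (f x) > z} = 0"
      show "Inf (ereal ` ?S) \<le> z"
      proof (cases z)
        case (real r)
        with z show ?thesis by (intro Inf_lower) auto
      next
        case MInf
        with z have A0: "emeasure lebesgue A = 0" by simp
        have "emeasure lebesgue {x \<in> A. f x > \<alpha>} = 0" for \<alpha>
        proof -
          have "emeasure lebesgue {x \<in> A. f x > \<alpha>} \<le> emeasure lebesgue A"
            using A by (intro emeasure_mono) auto
          with A0 show ?thesis by simp
        qed
        then have "?S = UNIV" by auto
        then have "Inf (ereal ` ?S) \<le> ereal r" for r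
          by (intro Inf_lower) auto
        then show ?thesis
          by (simp add: ereal_bot MInf)
      qed simp
    qed
  qed
qed

definition unif_tendsto_ae :: "(nat \<Rightarrow> L0) \<Rightarrow> L0 \<Rightarrow> bool" where
  "unif_tendsto_ae F g \<longleftrightarrow>
     (\<exists>E\<in>null_sets leb01. uniform_limit ({0..1} - E) (\<lambda>n. rep_L0 (F n)) (rep_L0 g) sequentially)"

text \<open>None of the conditions depends on the chosen representatives, since changing countably many
  functions on null sets amounts to discarding one null set.\<close>

definition NUP :: "(nat \<Rightarrow> L0) set" where
  "NUP = {F.
     (AE x in leb01. (\<lambda>n. rep_L0 (F n) x) \<longlonglongrightarrow> 0) \<and>
     (\<forall>\<epsilon>>0. \<exists>E\<in>sets leb01. measure leb01 E < \<epsilon> \<and>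
        (\<lambda>n. esssup (lebesgue_on ({0..1} - E)) (\<lambda>x. ereal \<bar>rep_L0 (F n) x\<bar>)) \<longlonglongrightarrow> 0) \<and>
     \<not> (\<exists>g. unif_tendsto_ae F g)}"

end

theory Submission
  imports Defs
begin

text \<open>Conditions on a sequence \<open>F\<close> in the family \<^const>\<open>NUP\<close> concern only the tail of \<open>F\<close>, so any
  finite initial piece may be prescribed. This gives density for free: if every sequence in an
  indexed family belongs to \<^const>\<open>NUP\<close>, then replacing, for each \<open>F\<close> and \<open>N\<close>, the first \<open>N\<close> terms
  of the member with index \<open>(F, N)\<close> by those of \<open>F\<close> stays inside \<^const>\<open>NUP\<close> and produces
  sequences converging coordinatewise to \<open>F\<close>.

  The tails are multiples \<open>s n\<close> of the indicators of the intervals \<open>(0, 1/(n+1))\<close>. Whatever the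
  scalars are, such a sequence is eventually zero at each point and vanishes eventually off
  \<open>[0, d]\<close> for each positive \<open>d\<close>; it converges uniformly a.e. only if \<open>s\<close> tends to zero
  (\<open>NUP_if_tail_spikes\<close>). What has to be found is therefore a family of scalar sequences, one for
  each pair \<open>(F, N)\<close>, no nontrivial combination of which tends to zero. Indicators of an almost
  disjoint family of infinite sets of natural numbers have this property
  (\<open>combination_of_branches_not_null\<close>): on all but finitely many points of one of the sets, a
  combination equals the corresponding coefficient. Such families can have the size of the
  continuum, and there are no more pairs \<open>(F, N)\<close> than that (\<open>inj_L0_seq_to_nat_sets\<close>), because a
  measurable function is a.e. the limit of a sequence of continuous functions.

  Nontrivial combinations of the modified sequences lie in \<^const>\<open>NUP\<close>, hence are nonzero, so the
  sequences are independent. Since there is one of them for every point of the whole space, a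
  Hamel basis of the space extending them has no larger cardinality, and their span has maximal
  dimension.\<close>

section \<open>The space has at most continuum many points\<close>

lemma continuous_eq_if_same_rational_cuts:
  fixes f g :: "real \<Rightarrow> real"
  assumes "continuous_on UNIV f" "continuous_on UNIV g"
    and cuts: "\<And>q r :: rat. of_rat r < f (of_rat q) \<longleftrightarrow> of_rat r < g (of_rat q)"
  shows "f = g"
proof -
  have le: "g x \<le> f x"
    if cont: "continuous_on UNIV f" "continuous_on UNIV g"
      and cuts: "\<And>q r :: rat. of_rat r < f (of_rat q) \<longleftrightarrow> of_rat r < g (of_rat q)"
    for f g :: "real \<Rightarrow> real" and x
  proof (rule ccontr)
    assume "\<not> g x \<le> f x"
    then obtain r where r: "f x < of_rat r" "of_rat r < g x"
      using of_rat_dense[of "f x" "g x"] by auto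
    have "isCont f x" "isCont g x"
      using cont by (simp_all add: continuous_on_eq_continuous_at)
    then have "\<forall>\<^sub>F y in nhds x. f y < of_rat r \<and> of_rat r < g y"
      using r by (intro eventually_conj order_tendstoD[where F = "nhds x"])
        (auto simp: isCont_def tendsto_at_iff_tendsto_nhds)
    then obtain e where e: "e > 0" "\<And>y. dist y x < e \<Longrightarrow> f y < of_rat r \<and> of_rat r < g y"
      by (auto simp: eventually_nhds_metric)
    obtain q where "x < of_rat q" "of_rat q < x + e"
      using of_rat_dense[of x "x + e"] e(1) by auto
    then show False
      using e(2)[of "of_rat q"] cuts[of r q] by (auto simp: dist_real_def)
  qed
  show ?thesis
    using le[OF assms] le[OF assms(2,1)] cuts by (intro ext antisym) auto
qed

lemma L0_limit_of_continuous:
  "\<exists>g. (\<forall>n. continuous_on UNIV (g n)) \<and> (AE x in leb01. (\<lambda>n. g n x) \<longlonglongrightarrow> rep_L0 f x)"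
proof -
  have "rep_L0 f measurable_on {0..1}"
    by (simp add: measurable_on_iff_borel_measurable)
  then obtain N g where N: "negligible N" and g: "\<And>n. continuous_on UNIV (g n)"
    "\<And>x. x \<notin> N \<Longrightarrow> (\<lambda>n. g n x) \<longlonglongrightarrow> (if x \<in> {0..1} then rep_L0 f x else 0)"
    unfolding measurable_on_def by blast
  have "AE x in lebesgue. x \<notin> N"
    using N by (simp add: negligible_iff_null_sets AE_not_in)
  then have "AE x in lebesgue. x \<in> {0..1} \<longrightarrow> (\<lambda>n. g n x) \<longlonglongrightarrow> rep_L0 f x"
  proof eventually_elim
    case (elim x)
    from g(2)[OF this] show ?case
      by auto
  qed
  then have "AE x in leb01. (\<lambda>n. g n x) \<longlonglongrightarrow> rep_L0 f x"
    by (subst AE_restrict_space_iff) simp_all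
  with g(1) show ?thesis
    by blast
qed

text \<open>A class is determined by continuous functions converging to it a.e., and a continuous function
  by its rational cuts at rational points; so countably many yes-no answers determine the class.\<close>

lemma inj_L0_to_sets: "\<exists>c :: L0 \<Rightarrow> (nat \<times> rat \<times> rat) set. inj c"
proof -
  obtain g where g: "\<And>f n. continuous_on UNIV (g f n)"
    "\<And>f. AE x in leb01. (\<lambda>n. g f n x) \<longlonglongrightarrow> rep_L0 f x"
    using L0_limit_of_continuous by metis
  have "inj (\<lambda>f. {(n, q, r). of_rat r < g f n (of_rat q)})"
  proof (rule injI)
    fix f1 f2
    assume eq: "{(n, q, r). of_rat r < g f1 n (of_rat q)} = {(n, q, r). of_rat r < g f2 n (of_rat q)}"
    have "of_rat r < g f1 n (of_rat q) \<longleftrightarrow> of_rat r < g f2 n (of_rat q)" for n q r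
      using eq by (auto simp: set_eq_iff)
    then have "g f1 n = g f2 n" for n
      by (intro continuous_eq_if_same_rational_cuts g)
    then have *: "g f1 = g f2" ..
    show "f1 = f2"
      unfolding L0_eq_iff using g(2)[of f1] g(2)[of f2]
      by eventually_elim (auto simp: * intro: LIMSEQ_unique)
  qed
  then show ?thesis
    by blast
qed

lemma inj_L0_seq_to_nat_sets: "\<exists>\<psi> :: (nat \<Rightarrow> L0) \<times> nat \<Rightarrow> nat set. inj \<psi>"
proof -
  obtain c :: "L0 \<Rightarrow> (nat \<times> rat \<times> rat) set" where c: "inj c"
    using inj_L0_to_sets by blast
  define D where "D = (\<lambda>(F :: nat \<Rightarrow> L0, N :: nat). insert (Inl N) (Inr ` (SIGMA i:UNIV. c (F i))))"
  have "inj D"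
  proof (rule injI, clarify)
    fix F G :: "nat \<Rightarrow> L0" and N K
    assume eq: "D (F, N) = D (G, K)"
    have "N = K"
    proof -
      have "Inl N \<in> D (G, K)"
        unfolding eq[symmetric] by (simp add: D_def)
      then show ?thesis by (auto simp: D_def)
    qed
    have "p \<in> c (F i) \<longleftrightarrow> p \<in> c (G i)" for i p
    proof -
      have "Inr (i, p) \<in> D (F, N) \<longleftrightarrow> Inr (i, p) \<in> D (G, K)"
        by (simp add: eq)
      then show ?thesis by (auto simp: D_def)
    qed
    then have "c (F i) = c (G i)" for i
      by blast
    then have "F = G"
      using c by (auto simp: inj_eq)
    with \<open>N = K\<close> show "F = G \<and> N = K" by simp
  qed
  then have "inj (\<lambda>i. to_nat ` D i)"
    by (intro injI) (auto simp: inj_image_eq_iff inj_eq)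
  then show ?thesis
    by blast
qed


section \<open>Almost disjoint sets of natural numbers\<close>

text \<open>Up to coding, \<open>branch S\<close> is the set of finite initial segments of \<open>S\<close>, a branch of the binary
  tree. Each segment is paired with its length, so that a finite set \<open>S\<close> also has infinitely many,
  and two branches separate at the first point where the sets differ.\<close>

definition branch :: "nat set \<Rightarrow> nat set" where
  "branch S = range (\<lambda>k. prod_encode (k, set_encode (S \<inter> {..<k})))"

lemma infinite_branch: "infinite (branch S)"
  unfolding branch_def by (rule range_inj_infinite) (auto intro!: injI)

lemma finite_branch_Int:
  assumes "S \<noteq> T"
  shows "finite (branch S \<inter> branch T)"
proof -
  obtain m where m: "m \<in> S \<longleftrightarrow> m \<notin> T"
    using assms by blast
  have "branch S \<inter> branch T \<subseteq> (\<lambda>k. prod_encode (k, set_encode (S \<inter> {..<k}))) ` {..m}"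
  proof
    fix n assume "n \<in> branch S \<inter> branch T"
    then obtain k where n: "n = prod_encode (k, set_encode (S \<inter> {..<k}))"
      and "set_encode (S \<inter> {..<k}) = set_encode (T \<inter> {..<k})"
      unfolding branch_def by auto
    then have "S \<inter> {..<k} = T \<inter> {..<k}"
      by (simp add: set_encode_eq)
    with m have "\<not> m < k"
      by blast
    then show "n \<in> (\<lambda>k. prod_encode (k, set_encode (S \<inter> {..<k}))) ` {..m}"
      using n by auto
  qed
  then show ?thesis
    by (rule finite_subset) simp
qed

text \<open>Each branch has infinitely many points outside the finitely many other branches of a
  combination; at these points the combination takes a constant nonzero value.\<close>

lemma combination_of_branches_not_null:
  fixes a :: "'i \<Rightarrow> real"
  assumes "inj \<psi>" "finite T" "j \<in> T" "a j \<noteq> 0"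
  shows "\<not> (\<lambda>n. \<Sum>i\<in>T. a i * indicator (branch (\<psi> i)) n) \<longlonglongrightarrow> 0"
proof
  define s where "s n = (\<Sum>i\<in>T. a i * indicator (branch (\<psi> i)) n)" for n
  assume "(\<lambda>n. \<Sum>i\<in>T. a i * indicator (branch (\<psi> i)) n) \<longlonglongrightarrow> 0"
  then have "s \<longlonglongrightarrow> 0"
    by (simp add: s_def[abs_def])
  define B where "B = branch (\<psi> j) - (\<Union>i\<in>T - {j}. branch (\<psi> j) \<inter> branch (\<psi> i))"
  have "infinite B"
    unfolding B_def using assms
    by (intro Diff_infinite_finite finite_UN_I infinite_branch finite_branch_Int)
      (auto simp: inj_eq)
  have "s n = a j" if "n \<in> B" for n
  proof -
    have "s n = (\<Sum>i\<in>{j}. a i * indicator (branch (\<psi> i)) n)"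
      unfolding s_def using that assms
      by (intro sum.mono_neutral_right) (auto simp: B_def)
    with that show ?thesis
      by (simp add: B_def)
  qed
  moreover have "\<forall>\<^sub>F n in sequentially. dist (s n) 0 < \<bar>a j\<bar>"
    using \<open>s \<longlonglongrightarrow> 0\<close> assms by (intro tendstoD) auto
  then obtain K where "\<And>n. n \<ge> K \<Longrightarrow> \<bar>s n\<bar> < \<bar>a j\<bar>"
    by (auto simp: eventually_sequentially)
  moreover obtain n where "n \<in> B" "n \<ge> K"
    using \<open>infinite B\<close> by (meson infinite_nat_iff_unbounded_le)
  ultimately show False
    by fastforce
qed


section \<open>Sequences with shrinking supports\<close>

definition spike :: "nat \<Rightarrow> L0" where
  "spike n = abs_L0 (indicator {0<..<1 / (real n + 1)})"

lemma rep_scaleR_L0: "AE x in leb01. rep_L0 (c *\<^sub>R f) x = c * rep_L0 f x"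
proof -
  have "c *\<^sub>R f = abs_L0 (\<lambda>x. c * rep_L0 f x)"
    using rep_L0_rel[of f] scaleR_L0.abs_eq[of "rep_L0 f" c] Quotient3_abs_rep[OF Quotient3_L0, of f]
    by simp
  then show ?thesis
    using rep_abs_L0[of "\<lambda>x. c * rep_L0 f x"] by simp
qed

lemma rep_spike: "AE x in leb01. rep_L0 (c *\<^sub>R spike n) x = c * indicator {0<..<1 / (real n + 1)} x"
proof -
  have meas: "(indicator {0<..<1 / (real n + 1)} :: real \<Rightarrow> real) \<in> borel_measurable leb01"
    by (intro measurable_restrict_space1 borel_measurable_indicator) auto
  show ?thesis
    using rep_scaleR_L0[of c "spike n"] rep_abs_L0[OF meas, folded spike_def]
    by eventually_elim simp
qed

text \<open>Extracts from a property holding a.e. a point inside a given interval, which is how a lower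
  bound on the size of a spike contradicts uniform convergence off a null set.\<close>

lemma AE_leb01_ex_open_interval:
  assumes "AE x in leb01. P x" "0 \<le> a" "a < b" "b \<le> 1"
  shows "\<exists>x. a < x \<and> x < b \<and> P x"
proof (rule ccontr)
  assume *: "\<not> (\<exists>x. a < x \<and> x < b \<and> P x)"
  have "AE x in lebesgue. x \<in> {0..1} \<longrightarrow> P x"
    using assms(1) by (simp add: AE_restrict_space_iff)
  then have "AE x in lebesgue. x \<notin> {a<..<b}"
    by eventually_elim (use * assms(2-4) in auto)
  then have "{a<..<b} \<in> null_sets lebesgue"
    by (subst AE_iff_null_sets) auto
  with assms(3) show False
    by (simp add: null_sets_def)
qed

text \<open>The supports shrink to the empty set, which gives the pointwise limit zero for all scalars, and
  removing \<open>[0, d]\<close> removes all but finitely many supports. As each support has positive measure,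
  uniform closeness off a null set to the only possible limit, zero, bounds the scalar itself.\<close>

lemma NUP_if_tail_spikes:
  assumes tail: "\<forall>\<^sub>F n in sequentially. F n = s n *\<^sub>R spike n"
    and s: "\<not> s \<longlonglongrightarrow> 0"
  shows "F \<in> NUP"
proof -
  obtain N where N: "\<And>n. n \<ge> N \<Longrightarrow> F n = s n *\<^sub>R spike n"
    using tail by (auto simp: eventually_sequentially)
  have rep: "AE x in leb01. \<forall>n\<ge>N. rep_L0 (F n) x = s n * indicator {0<..<1 / (real n + 1)} x"
    using N rep_spike by (auto simp: AE_all_countable)
  have small: "\<forall>\<^sub>F n in sequentially. N \<le> n \<and> 1 / (real n + 1) < d" if "d > 0" for d
  proof (intro eventually_conj eventually_ge_at_top)
    have "(\<lambda>n. 1 / (real n + 1)) \<longlonglongrightarrow> 0"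
      using LIMSEQ_inverse_real_of_nat by (simp add: inverse_eq_divide add.commute)
    then show "\<forall>\<^sub>F n in sequentially. 1 / (real n + 1) < d"
      using that by (rule order_tendstoD)
  qed
  have A: "AE x in leb01. (\<lambda>n. rep_L0 (F n) x) \<longlonglongrightarrow> 0"
    using rep
  proof eventually_elim
    case (elim x)
    have "\<forall>\<^sub>F n in sequentially. rep_L0 (F n) x = 0"
    proof (cases "x > 0")
      case True
      show ?thesis
        using small[OF True] by eventually_elim (use elim in auto)
    next
      case False
      show ?thesis
        using eventually_ge_at_top[of N] by eventually_elim (use elim False in auto)
    qed
    then show ?case
      by (rule tendsto_eventually)
  qed
  have B: "\<exists>E\<in>sets leb01. measure leb01 E < \<epsilon> \<and>
      (\<lambda>n. esssup (lebesgue_on ({0..1} - E)) (\<lambda>x. ereal \<bar>rep_L0 (F n) x\<bar>)) \<longlonglongrightarrow> 0"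
    if "\<epsilon> > 0" for \<epsilon>
  proof -
    \<comment> \<open>The complement must have positive measure: over a null set the essential supremum is
      minus infinity.\<close>
    define d where "d = min (\<epsilon> / 2) (1 / 2)"
    have d: "0 < d" "d < \<epsilon>" "d \<le> 1 / 2"
      using that by (auto simp: d_def)
    have E: "{0..d} \<in> sets leb01"
      using d by (auto simp: sets_restrict_space_iff)
    have compl: "{0..1} - {0..d} = {d<..1}"
      using d by auto
    have "measure leb01 {0..d} = d"
      using d by (subst measure_restrict_space) auto
    moreover have "\<forall>\<^sub>F n in sequentially.
        esssup (lebesgue_on {d<..1}) (\<lambda>x. ereal \<bar>rep_L0 (F n) x\<bar>) = 0"
      using small[OF d(1)]
    proof eventually_elim
      case (elim n)
      have "AE x in lebesgue. x \<in> {0..1} \<longrightarrow> rep_L0 (F n) x = s n * indicator {0<..<1 / (real n + 1)} x"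
        using rep elim by (auto simp: AE_restrict_space_iff elim!: eventually_mono)
      then have "AE x in lebesgue_on {d<..1}. ereal \<bar>rep_L0 (F n) x\<bar> = 0"
        using elim d by (subst AE_restrict_space_iff) (auto elim!: eventually_mono)
      moreover have "(\<lambda>x. ereal \<bar>rep_L0 (F n) x\<bar>) \<in> borel_measurable (lebesgue_on {d<..1})"
      proof -
        have "rep_L0 (F n) \<in> borel_measurable (lebesgue_on {d<..1})"
          by (rule measurable_restrict_mono[OF rep_L0_measurable]) (use d in auto)
        then show ?thesis by measurable
      qed
      ultimately have "esssup (lebesgue_on {d<..1}) (\<lambda>x. ereal \<bar>rep_L0 (F n) x\<bar>)
          = esssup (lebesgue_on {d<..1}) (\<lambda>x. 0)"
        by (intro esssup_AE_cong) auto
      also have "\<dots> = 0"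
        using d by (intro esssup_const) (simp add: emeasure_restrict_space)
      finally show ?case .
    qed
    ultimately show ?thesis
      using E d compl by (intro bexI[of _ "{0..d}"]) (auto intro: tendsto_eventually)
  qed
  have C: "\<not> unif_tendsto_ae F g" for g
  proof
    assume "unif_tendsto_ae F g"
    then obtain E where E: "E \<in> null_sets leb01"
      and lim: "uniform_limit ({0..1} - E) (\<lambda>n. rep_L0 (F n)) (rep_L0 g) sequentially"
      by (auto simp: unif_tendsto_ae_def)
    have good: "AE x in leb01. x \<notin> E \<and> rep_L0 g x = 0 \<and>
        (\<forall>n\<ge>N. rep_L0 (F n) x = s n * indicator {0<..<1 / (real n + 1)} x)"
      using AE_not_in[OF E] A rep AE_space
    proof eventually_elim
      case (elim x)
      then have "x \<in> {0..1} - E"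
        by simp
      from tendsto_uniform_limitI[OF lim this] elim show ?case
        using LIMSEQ_unique by blast
    qed
    have "s \<longlonglongrightarrow> 0"
    proof (rule tendstoI)
      fix e :: real assume "e > 0"
      with lim have "\<forall>\<^sub>F n in sequentially. \<forall>x\<in>{0..1} - E. dist (rep_L0 (F n) x) (rep_L0 g x) < e"
        by (rule uniform_limitD)
      then show "\<forall>\<^sub>F n in sequentially. dist (s n) 0 < e"
        using eventually_ge_at_top[of N]
      proof eventually_elim
        case (elim n)
        obtain x where x: "0 < x" "x < 1 / (real n + 1)" "x \<notin> E" "rep_L0 g x = 0"
          "rep_L0 (F n) x = s n * indicator {0<..<1 / (real n + 1)} x"
          using AE_leb01_ex_open_interval[OF good, of 0 "1 / (real n + 1)"] elim by auto
        have "1 / (real n + 1) \<le> 1"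
          by simp
        then have "x \<le> 1"
          using x(2) by linarith
        with x have "x \<in> {0..1} - E"
          by auto
        with elim(1) have "dist (rep_L0 (F n) x) (rep_L0 g x) < e"
          by blast
        with x show ?case
          by simp
      qed
    qed
    with s show False ..
  qed
  show ?thesis
    unfolding NUP_def using A B C by blast
qed

lemma zero_notin_NUP: "0 \<notin> NUP"
proof -
  have "unif_tendsto_ae 0 0"
    unfolding unif_tendsto_ae_def by (intro bexI[of _ "{}"]) (auto intro: uniform_limit_const)
  then show ?thesis
    by (auto simp: NUP_def)
qed


section \<open>Independent families and the dimension of their spans\<close>

text \<open>Nonzero vectors of the span are nontrivial combinations. As zero is outside \<open>A\<close>, the same
  hypothesis also gives injectivity, through differences of two members, and independence.\<close>

lemma independent_family_if_combinations:
  fixes h :: "'i \<Rightarrow> 'a::real_vector"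
  assumes comb: "\<And>T a j. finite T \<Longrightarrow> j \<in> T \<Longrightarrow> a j \<noteq> 0 \<Longrightarrow> (\<Sum>i\<in>T. a i *\<^sub>R h i) \<in> A"
    and "0 \<notin> A"
  shows "inj h" "independent (range h)" "span (range h) - {0} \<subseteq> A"
proof -
  show "inj h"
  proof (rule injI, rule ccontr)
    fix i j assume ij: "h i = h j" "i \<noteq> j"
    have "(\<Sum>k\<in>{i, j}. (if k = i then 1 else - 1) *\<^sub>R h k) \<in> A"
      by (rule comb[where j = i]) auto
    with ij \<open>0 \<notin> A\<close> show False
      by simp
  qed
  have comb': "(\<Sum>v\<in>T. a v *\<^sub>R v) \<in> A" if "finite T" "T \<subseteq> range h" "w \<in> T" "a w \<noteq> 0" for T a w
  proof -
    have *: "bij_betw h (h -` T) T"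
      using \<open>inj h\<close> that by (auto simp: bij_betw_def inj_on_def)
    have "(\<Sum>i\<in>h -` T. a (h i) *\<^sub>R h i) = (\<Sum>v\<in>T. a v *\<^sub>R v)"
      by (rule sum.reindex_bij_betw[OF *])
    moreover obtain j where "w = h j"
      using \<open>T \<subseteq> range h\<close> \<open>w \<in> T\<close> by blast
    ultimately show ?thesis
      using comb[of "h -` T" j "\<lambda>i. a (h i)"] that \<open>inj h\<close> by (simp add: finite_vimageI)
  qed
  show "independent (range h)"
    unfolding dependent_explicit using comb' \<open>0 \<notin> A\<close> by metis
  show "span (range h) - {0} \<subseteq> A"
  proof
    fix x assume "x \<in> span (range h) - {0}"
    then obtain T a where T: "finite T" "T \<subseteq> range h" and x: "x = (\<Sum>v\<in>T. a v *\<^sub>R v)" "x \<noteq> 0"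
      by (auto simp: span_explicit)
    then obtain w where "w \<in> T" "a w \<noteq> 0"
      by (metis (no_types, lifting) scale_zero_left sum.neutral)
    with T comb' x(1) show "x \<in> A"
      by blast
  qed
qed

text \<open>A Hamel basis of the whole space that extends \<open>B\<close> lies between \<open>B\<close> and the space, so the three
  are equipotent.\<close>

lemma same_hamel_dim_span_if_large:
  fixes B :: "'a::real_vector set"
  assumes "independent B" "(UNIV :: 'a set) \<lesssim> B"
  shows "same_hamel_dim (span B) (UNIV :: 'a set)"
proof -
  obtain C where C: "B \<subseteq> C" "independent C" "UNIV \<subseteq> span C"
    using maximal_independent_subset_extend[of B UNIV] assms(1) by auto
  have "C \<lesssim> B"
    using subset_imp_lepoll[of C UNIV] assms(2) lepoll_trans by blast
  then have "B \<approx> C"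
    using subset_imp_lepoll[OF C(1)] by (simp add: lepoll_antisym)
  then show ?thesis
    unfolding same_hamel_dim_def is_hamel_basis_def using assms(1) C by blast
qed


section \<open>Maximal dense-lineability\<close>

lemma sum_fun_apply: "(\<Sum>i\<in>T. f i) n = (\<Sum>i\<in>T. f i n)"
  for f :: "'i \<Rightarrow> 'a \<Rightarrow> 'b::real_vector"
  by (induction T rule: infinite_finite_induct) auto

lemma in_closure_if_tendsto:
  fixes X :: "nat \<Rightarrow> 'a::topological_space"
  assumes "X \<longlonglongrightarrow> l" "\<And>n. X n \<in> S"
  shows "l \<in> closure S"
proof (rule Lim_in_closed_set[OF closed_closure _ _ assms(1)])
  show "\<forall>\<^sub>F n in sequentially. X n \<in> closure S"
    using assms(2) closure_subset by (intro always_eventually) blast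
qed simp

theorem theorem3p7:
  shows "maximal_dense_lineable NUP"
proof -
  obtain \<psi> :: "(nat \<Rightarrow> L0) \<times> nat \<Rightarrow> nat set" where \<psi>: "inj \<psi>"
    using inj_L0_seq_to_nat_sets by blast
  define h where "h = (\<lambda>i n. if n < snd i then fst i n else indicator (branch (\<psi> i)) n *\<^sub>R spike n)"
  have comb: "(\<Sum>i\<in>T. a i *\<^sub>R h i) \<in> NUP" if "finite T" "j \<in> T" "a j \<noteq> 0" for T a j
  proof (rule NUP_if_tail_spikes)
    show "\<not> (\<lambda>n. \<Sum>i\<in>T. a i * indicator (branch (\<psi> i)) n) \<longlonglongrightarrow> 0"
      using \<psi> that by (rule combination_of_branches_not_null)
    have "\<forall>\<^sub>F n in sequentially. \<forall>i\<in>T. snd i \<le> n"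
      using \<open>finite T\<close> by (simp add: eventually_ball_finite_distrib eventually_ge_at_top)
    then show "\<forall>\<^sub>F n in sequentially. (\<Sum>i\<in>T. a i *\<^sub>R h i) n =
        (\<Sum>i\<in>T. a i * indicator (branch (\<psi> i)) n) *\<^sub>R spike n"
    proof eventually_elim
      case (elim n)
      then have "h i n = indicator (branch (\<psi> i)) n *\<^sub>R spike n" if "i \<in> T" for i
        using that by (auto simp: h_def)
      then show ?case
        by (simp add: sum_fun_apply scaleR_sum_left)
    qed
  qed
  \<comment> \<open>The members at \<open>(F, N)\<close> for varying \<open>N\<close> give density, those at \<open>(F, 0)\<close> give the dimension.\<close>
  note fam = independent_family_if_combinations[OF comb zero_notin_NUP]
  have dense: "closure (span (range h)) = UNIV"
  proof (intro equalityI subset_UNIV subsetI)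
    fix F :: "nat \<Rightarrow> L0"
    have "(\<lambda>N. h (F, N)) \<longlonglongrightarrow> F"
      unfolding tendsto_fun_iff
    proof
      fix n
      have "\<forall>\<^sub>F N in sequentially. h (F, N) n = F n"
        using eventually_gt_at_top[of n] by eventually_elim (simp add: h_def)
      then show "(\<lambda>N. h (F, N) n) \<longlonglongrightarrow> F n"
        by (rule tendsto_eventually)
    qed
    moreover have "h (F, N) \<in> span (range h)" for N
      by (intro span_base rangeI)
    ultimately show "F \<in> closure (span (range h))"
      by (rule in_closure_if_tendsto)
  qed
  have "inj (\<lambda>F. h (F, 0))"
    using fam(1) by (auto simp: inj_def)
  then have "(UNIV :: (nat \<Rightarrow> L0) set) \<lesssim> range h"
    unfolding lepoll_def by blast
  with fam(2) have "same_hamel_dim (span (range h)) (UNIV :: (nat \<Rightarrow> L0) set)"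
    by (rule same_hamel_dim_span_if_large)
  with dense fam(3) show ?thesis
    unfolding maximal_dense_lineable_def
    by (intro exI[of _ "span (range h)"] conjI subspace_span)
qed

end
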